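(* Let $n\ge2$ and let $S=(s_1,\ldots,s_n)\in\mathcal{G}_n$ have right anti-diagonal $(e_1,\ldots,e_{n-1})$. Let $T_{n-1}:=\{1\}$ and recursively $T_{i-1}:=P_{e_i}(T_i)$ for $i=n-1,n-2,\ldots,1$. Then $$D_S:=\{|k-s_n|:k\in K_S\}=T_0,$$ and $K_S=\{s_n+d:d\in D_S\}\cup\{s_n-d:d\in D_S\}$.
   Context: For a finite integer sequence $S=(s_1,\ldots,s_n)$, its difference triangle is defined by $s_a^0:=s_a$ and $s_a^b:=|s_{a+1}^{b-1}-s_a^{b-1}|$ for $b\ge 1$, $1\le a\le n-b$ (superscripts are row indices, not powers). $S$ is Gilbreath if $s_1^b=1$ for every $1\le b\le n-1$. For $n\ge 2$, $\mathcal{G}_n$ is the set of strictly increasing Gilbreath integer sequences $(s_1,\ldots,s_n)$ of length $n$ with $(s_1,s_2)=(2,3)$. The valid-extension set of $S$ is $K_S:=\{k\in\mathbb{Z}:(s_1,\ldots,s_n,k)\text{ is Gilbreath}\}$. The right anti-diagonal of $S$ is $(e_1,\ldots,e_{n-1})$ with $e_i:=s_{n-i}^i$. For $e\in\mathbb{Z}_{\ge0}$ and $T\subseteq\mathbb{Z}_{\ge0}$, the preimage step is $P_e(T):=\{e+t:t\in T\}\cup\{e-t:t\in T,\ e\ge t\}$. *)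

theory Defs
  imports Main
begin

(* A finite integer sequence (s_1, ..., s_n) is a list of length n. Indices a are
   1-based, so s_a is S ! (a - 1). The value diff_triangle S b a is the entry s_a^b;
   it is meaningful only for 1 <= a <= length S - b. *)
fun diff_triangle :: "int list \<Rightarrow> nat \<Rightarrow> nat \<Rightarrow> int" where
  "diff_triangle S 0 a = S ! (a - 1)"
| "diff_triangle S (Suc b) a = \<bar>diff_triangle S b (a + 1) - diff_triangle S b a\<bar>"

definition gilbreath :: "int list \<Rightarrow> bool" where
  "gilbreath S \<longleftrightarrow> (\<forall>b \<in> {1..length S - 1}. diff_triangle S b 1 = 1)"

(* Only used for n >= 2. *)
definition gilbreath_seqs :: "nat \<Rightarrow> int list set" where
  "gilbreath_seqs n =
     {S. length S = n \<and> sorted_wrt (<) S \<and> gilbreath S \<and> S ! 0 = 2 \<and> S ! 1 = 3}"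

(* An extension need not be larger than the last term of S. *)
definition valid_extensions :: "int list \<Rightarrow> int set" where
  "valid_extensions S = {k. gilbreath (S @ [k])}"

definition right_antidiagonal :: "int list \<Rightarrow> nat \<Rightarrow> int" where
  "right_antidiagonal S i = diff_triangle S i (length S - i)"

(* Intended for e >= 0 and sets T of nonnegative integers; the result is then again
   a set of nonnegative integers. *)
definition preimage_step :: "int \<Rightarrow> int set \<Rightarrow> int set" where
  "preimage_step e T = {e + t | t. t \<in> T} \<union> {e - t | t. t \<in> T \<and> e \<ge> t}"

definition extension_distances :: "int list \<Rightarrow> int set" where
  "extension_distances S = {\<bar>k - last S\<bar> | k. k \<in> valid_extensions S}"

end

theory Submission
  imports Defs
begin

text \<open>Appending \<open>k\<close> to \<open>S\<close> adds one anti-diagonal \<open>f\<^sub>0 = k, f\<^sub>1, \<dots>, f\<^sub>n\<close> to the difference triangle, with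
  \<open>f\<^sub>1 = \<bar>k - s\<^sub>n\<bar>\<close> and \<open>f\<^sub>i\<^sub>+\<^sub>1 = \<bar>f\<^sub>i - e\<^sub>i\<bar>\<close>, and the extension is Gilbreath iff \<open>f\<^sub>n = 1\<close>. The preimage of a
  set \<open>T\<close> of nonnegative integers under \<open>x \<mapsto> \<bar>x - e\<bar>\<close> on the nonnegative integers is \<open>P\<^sub>e(T)\<close>, so pulling
  the condition \<open>f\<^sub>n \<in> {1}\<close> back along the anti-diagonal turns it into \<open>\<bar>k - s\<^sub>n\<bar> \<in> T\<^sub>0\<close>.\<close>

text \<open>Position \<open>a\<close> in row \<open>b\<close> reads only terms \<open>a\<close> to
  \<open>a + b\<close>.\<close>

lemma diff_triangle_append:
  assumes "1 \<le> a" "a + b \<le> length S"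
  shows "diff_triangle (S @ R) b a = diff_triangle S b a"
  using assms
proof (induction b arbitrary: a)
  case 0
  then have "a - 1 < length S" by linarith
  then show ?case by (simp add: nth_append)
next
  case (Suc b)
  then show ?case using Suc.IH[of a] Suc.IH[of "a + 1"] by simp
qed

text \<open>The two entries above the new one are neighbours in row \<open>i\<close>: the last one
  of \<open>S @ [k]\<close> and, left of it, the last one of \<open>S\<close>.\<close>

lemma right_antidiagonal_snoc_Suc:
  assumes "i < length S"
  shows "right_antidiagonal (S @ [k]) (Suc i)
         = \<bar>right_antidiagonal (S @ [k]) i - right_antidiagonal S i\<bar>"
proof -
  have "diff_triangle (S @ [k]) i (length S - i) = diff_triangle S i (length S - i)"
    using assms by (intro diff_triangle_append) auto
  then show ?thesis
    using assms by (simp add: right_antidiagonal_def Suc_diff_le)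
qed

lemma right_antidiagonal_snoc_1:
  assumes "S \<noteq> []"
  shows "right_antidiagonal (S @ [k]) 1 = \<bar>k - last S\<bar>"
  using assms right_antidiagonal_snoc_Suc[of 0 S k]
  by (simp add: right_antidiagonal_def last_conv_nth)

lemma right_antidiagonal_nonneg:
  assumes "0 < i"
  shows "right_antidiagonal S i \<ge> 0"
  using assms by (cases i) (simp_all add: right_antidiagonal_def)

text \<open>The first column gains one entry, in row \<open>length S\<close>; it is alone in its
  row, so it ends the new anti-diagonal.\<close>

lemma gilbreath_snoc:
  assumes "S \<noteq> []" "gilbreath S"
  shows "gilbreath (S @ [k]) \<longleftrightarrow> right_antidiagonal (S @ [k]) (length S) = 1"
proof -
  have old: "diff_triangle (S @ [k]) b 1 = 1" if "b \<in> {1..length S - 1}" for b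
    using assms that diff_triangle_append[of 1 b S "[k]"] by (force simp: gilbreath_def)
  have "{1..length (S @ [k]) - 1} = insert (length S) {1..length S - 1}"
    using assms(1) by (cases S) auto
  then show ?thesis
    using old by (simp add: gilbreath_def right_antidiagonal_def)
qed

text \<open>With \<open>t = \<bar>x - e\<bar>\<close>, \<open>x\<close> is \<open>e + t\<close> or
  \<open>e - t\<close>; in the second case the guard \<open>e \<ge> t\<close> is exactly
  \<open>x \<ge> 0\<close>.\<close>

lemma mem_preimage_step_iff:
  assumes "e \<ge> 0" "\<And>t. t \<in> T \<Longrightarrow> t \<ge> 0"
  shows "x \<in> preimage_step e T \<longleftrightarrow> x \<ge> 0 \<and> \<bar>x - e\<bar> \<in> T"
proof
  assume "x \<in> preimage_step e T"
  then show "x \<ge> 0 \<and> \<bar>x - e\<bar> \<in> T"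
    using assms unfolding preimage_step_def by fastforce
next
  assume *: "x \<ge> 0 \<and> \<bar>x - e\<bar> \<in> T"
  then have "x = e + \<bar>x - e\<bar> \<or> x = e - \<bar>x - e\<bar> \<and> e \<ge> \<bar>x - e\<bar>" by linarith
  with * show "x \<in> preimage_step e T"
    unfolding preimage_step_def by blast
qed

theorem proposition18:
  fixes n :: nat and S :: "int list" and T :: "nat \<Rightarrow> int set"
  assumes "n \<ge> 2"
    and "S \<in> gilbreath_seqs n"
    and "T (n - 1) = {1}"
    and "\<forall>i \<in> {1..n - 1}. T (i - 1) = preimage_step (right_antidiagonal S i) (T i)"
  shows "extension_distances S = T 0 \<and>
    valid_extensions S =
      {last S + d | d. d \<in> extension_distances S} \<union> {last S - d | d. d \<in> extension_distances S}"
proof -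
  have len: "length S = n" and gil: "gilbreath S"
    using assms(2) by (auto simp: gilbreath_seqs_def)
  then have ne: "S \<noteq> []" using assms(1) by auto
  have step: "T i = preimage_step (right_antidiagonal S (Suc i)) (T (Suc i))" if "i < n - 1" for i
    using assms(4) that by (auto dest: bspec[of _ _ "Suc i"])
  have T_iff: "x \<in> T i \<longleftrightarrow> x \<ge> 0 \<and> \<bar>x - right_antidiagonal S (Suc i)\<bar> \<in> T (Suc i)"
    if "i < n - 1" "\<forall>t \<in> T (Suc i). t \<ge> 0" for x i
    using that step mem_preimage_step_iff[OF right_antidiagonal_nonneg] by simp
  have nonneg: "\<forall>t \<in> T i. t \<ge> 0" if "i \<le> n - 1" for i
    using that by (induction rule: inc_induct) (use assms(3) T_iff in auto)
  \<comment> \<open>Downward induction from \<open>i = n - 1\<close>, where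
    \<open>T i = {1}\<close>. The indices differ by one because \<open>T i\<close> constrains entry
    \<open>Suc i\<close> of the new anti-diagonal.\<close>
  have pull: "right_antidiagonal (S @ [k]) (Suc i) \<in> T i \<longleftrightarrow> right_antidiagonal (S @ [k]) n = 1"
    if "i \<le> n - 1" for i k
    using that
  proof (induction rule: inc_induct)
    case base
    then show ?case using assms(1,3) by simp
  next
    case (step i)
    then show ?case
      using T_iff[of i] nonneg[of "Suc i"] right_antidiagonal_snoc_Suc[of "Suc i" S k]
        right_antidiagonal_nonneg[of "Suc i" "S @ [k]"] len by simp
  qed
  have K: "k \<in> valid_extensions S \<longleftrightarrow> \<bar>k - last S\<bar> \<in> T 0" for k
    using pull[of 0 k] gilbreath_snoc[OF ne gil, of k] right_antidiagonal_snoc_1[OF ne, of k] len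
    by (simp add: valid_extensions_def)
  have T0: "t \<ge> 0" if "t \<in> T 0" for t
    using nonneg[of 0] that by simp
  have D: "extension_distances S = T 0"
  proof
    show "extension_distances S \<subseteq> T 0"
      using K by (auto simp: extension_distances_def)
    \<comment> \<open>\<open>K\<close> sees only the distance to \<open>last S\<close>, so the
      candidate on the right serves as witness.\<close>
    have "t = \<bar>(last S + t) - last S\<bar> \<and> last S + t \<in> valid_extensions S" if "t \<in> T 0" for t
      using K T0 that by simp
    then show "T 0 \<subseteq> extension_distances S"
      unfolding extension_distances_def by blast
  qed
  have "k \<in> valid_extensions S \<longleftrightarrow> (\<exists>d \<in> T 0. k = last S + d \<or> k = last S - d)" for k
  proof
    have "k = last S + \<bar>k - last S\<bar> \<or> k = last S - \<bar>k - last S\<bar>" by linarith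
    then show "\<exists>d \<in> T 0. k = last S + d \<or> k = last S - d" if "k \<in> valid_extensions S"
      using K that by blast
    show "k \<in> valid_extensions S" if "\<exists>d \<in> T 0. k = last S + d \<or> k = last S - d"
      using K T0 that by fastforce
  qed
  then show ?thesis
    using D by blast
qed

end
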